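(* Let $\Lambda\subset\mathbb{R}^2$ be a lattice with a Minkowski-reduced basis $\{v_1,v_2\}=\{(1,0),(a,b)\}$ such that the angle $\theta$ between $v_1$ and $v_2$ satisfies $\frac{\pi}{3}\le\theta\le\frac{\pi}{2}$. Then the probability of error $P_e$ for the Babai partition associated with this basis is $$P_e=F(a,b)=\frac{a-a^2}{4b^2}.$$
   Context: A (full rank) lattice $\Lambda\subset\mathbb{R}^n$ with basis $\{v_1,\dots,v_n\}$ is the set of integer linear combinations of the linearly independent vectors $v_1,\dots,v_n$. A basis $\{v_1,\dots,v_n\}$ of $\Lambda$ is Minkowski-reduced if for each $j=1,\dots,n$ one has $\|v_j\|\le\|v\|$ for every $v$ such that $\{v_1,\dots,v_{j-1},v\}$ can be extended to a basis of $\Lambda$ (Euclidean norm). The Voronoi cell of $0$ is $\mathcal{V}(0)=\{x\in\mathbb{R}^n:\|x\|\le\|x-\tilde\lambda\|\text{ for all }\tilde\lambda\in\Lambda\}$. Nearest plane (Babai) algorithm for the basis $\{v_1,\dots,v_n\}$: let $\mathcal{S}_i$ be the span of $v_1,\dots,v_i$ (with $\mathcal{S}_0=\{0\}$), $\mathcal{P}_i$ the orthogonal projection onto $\mathcal{S}_i$, $v_{i,i-1}=\mathcal{P}_{i-1}(v_i)$ and $v_{i,i-1}^\perp=v_i-v_{i,i-1}$. Given $x$, set $z_n=x$ and, for $i=n,n-1,\dots,1$, let $b_i=\left[\langle z_i,v_{i,i-1}^\perp\rangle/\|v_{i,i-1}^\perp\|^2\right]$ (where $[\cdot]$ is the nearest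 integer) and $z_{i-1}=\mathcal{P}_{i-1}(z_i)-b_iv_{i,i-1}$. The Babai point of $x$ is $x_{np}=b_1v_1+\dots+b_nv_n$. The Babai cell $\mathcal{B}(0)$ is the set of $x$ with $x_{np}=0$; for the basis $\{(1,0),(a,b)\}$ of a lattice in $\mathbb{R}^2$ it is, up to boundary, the rectangle with vertices $(\pm\frac12,\pm\frac b2)$. The probability of error (for $n=2$) is $$P_e=\frac{\mathrm{area}(\mathcal{B}(0)\cap\mathcal{V}(0)^c)}{\mathrm{area}(\mathcal{B}(0))},$$ where $\mathcal{V}(0)^c$ is the complement of $\mathcal{V}(0)$ and area is Lebesgue measure. *)

theory Defs
  imports "HOL-Analysis.Analysis"
begin

text \<open>
  An ordered basis of \<open>\<real>\<^sup>n\<close>, where \<open>n = CARD('n)\<close>, is a function \<open>v\<close> on \<open>nat\<close> of which only the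
  values \<open>v 1, \<dots>, v n\<close> matter.
\<close>

definition lattice_basis :: "(real ^ 'n) set \<Rightarrow> (nat \<Rightarrow> real ^ 'n) \<Rightarrow> bool" where
  "lattice_basis L v \<longleftrightarrow>
     inj_on v {1..CARD('n)} \<and> independent (v ` {1..CARD('n)}) \<and>
     L = {(\<Sum>i = 1..CARD('n). real_of_int (c i) *\<^sub>R v i) | c :: nat \<Rightarrow> int. True}"

text \<open>
  In the following, \<open>w\<close> is a basis that extends \<open>v 1, \<dots>, v (j - 1), u\<close>. Being injective on
  \<open>{1..n}\<close>, it forces \<open>u\<close> to differ from \<open>v 1, \<dots>, v (j - 1)\<close>.
\<close>

definition minkowski_reduced :: "(real ^ 'n) set \<Rightarrow> (nat \<Rightarrow> real ^ 'n) \<Rightarrow> bool" where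
  "minkowski_reduced L v \<longleftrightarrow>
     lattice_basis L v \<and>
     (\<forall>j\<in>{1..CARD('n)}. \<forall>u.
        (\<exists>w. lattice_basis L w \<and> (\<forall>i\<in>{1..<j}. w i = v i) \<and> w j = u) \<longrightarrow> norm (v j) \<le> norm u)"

definition voronoi_cell :: "(real ^ 'n) set \<Rightarrow> (real ^ 'n) set" where
  "voronoi_cell L = {x. \<forall>l\<in>L. norm x \<le> norm (x - l)}"

definition vec_angle :: "real ^ 'n \<Rightarrow> real ^ 'n \<Rightarrow> real" where
  "vec_angle x y = arccos ((x \<bullet> y) / (norm x * norm y))"

definition orth_proj :: "(real ^ 'n) set \<Rightarrow> real ^ 'n \<Rightarrow> real ^ 'n" where
  "orth_proj S x = (THE p. p \<in> S \<and> (\<forall>s\<in>S. orthogonal (x - p) s))"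

lemma orth_proj_eqI:
  assumes "subspace S" "p \<in> S" "\<And>s. s \<in> S \<Longrightarrow> orthogonal (x - p) s"
  shows "orth_proj S x = p"
  unfolding orth_proj_def
proof (rule the_equality)
  fix q assume q: "q \<in> S \<and> (\<forall>s\<in>S. orthogonal (x - q) s)"
  have "p - q \<in> S"
    using assms(1,2) q by (simp add: subspace_diff)
  then have "(x - q) \<bullet> (p - q) = 0" "(x - p) \<bullet> (p - q) = 0"
    using q assms(3) by (auto simp: orthogonal_def)
  then have "(p - q) \<bullet> (p - q) = 0"
    by (simp add: inner_diff_left)
  then show "q = p" by simp
qed (use assms in auto)

text \<open>
  With \<open>S i = span {v 1, \<dots>, v i}\<close>, the vector \<open>v i\<close> is split into its projection \<open>basis_par v i\<close>
  onto \<open>S (i - 1)\<close> and the remainder \<open>basis_perp v i\<close>. The function \<open>round\<close> rounds half-integers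
  upwards, which affects the cell below only on its boundary.
\<close>

definition basis_span :: "(nat \<Rightarrow> real ^ 'n) \<Rightarrow> nat \<Rightarrow> (real ^ 'n) set" where
  "basis_span v i = span (v ` {1..i})"

definition basis_par :: "(nat \<Rightarrow> real ^ 'n) \<Rightarrow> nat \<Rightarrow> real ^ 'n" where
  "basis_par v i = orth_proj (basis_span v (i - 1)) (v i)"

definition basis_perp :: "(nat \<Rightarrow> real ^ 'n) \<Rightarrow> nat \<Rightarrow> real ^ 'n" where
  "basis_perp v i = v i - basis_par v i"

definition babai_coeff :: "(nat \<Rightarrow> real ^ 'n) \<Rightarrow> nat \<Rightarrow> real ^ 'n \<Rightarrow> int" where
  "babai_coeff v i z = round ((z \<bullet> basis_perp v i) / (norm (basis_perp v i))\<^sup>2)"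

definition babai_step :: "(nat \<Rightarrow> real ^ 'n) \<Rightarrow> nat \<Rightarrow> real ^ 'n \<Rightarrow> real ^ 'n" where
  "babai_step v i z =
     orth_proj (basis_span v (i - 1)) z - real_of_int (babai_coeff v i z) *\<^sub>R basis_par v i"

text \<open>
  \<open>nearest_plane v i z\<close> is \<open>b\<^sub>1 v\<^sub>1 + \<dots> + b\<^sub>i v\<^sub>i\<close> for the algorithm entered at level \<open>i\<close> with
  \<open>z\<^sub>i = z\<close>.
\<close>

primrec nearest_plane :: "(nat \<Rightarrow> real ^ 'n) \<Rightarrow> nat \<Rightarrow> real ^ 'n \<Rightarrow> real ^ 'n" where
  "nearest_plane v 0 z = 0"
| "nearest_plane v (Suc i) z =
     nearest_plane v i (babai_step v (Suc i) z) + real_of_int (babai_coeff v (Suc i) z) *\<^sub>R v (Suc i)"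

definition babai_point :: "(nat \<Rightarrow> real ^ 'n) \<Rightarrow> real ^ 'n \<Rightarrow> real ^ 'n" where
  "babai_point v x = nearest_plane v CARD('n) x"

definition babai_cell :: "(nat \<Rightarrow> real ^ 'n) \<Rightarrow> (real ^ 'n) set" where
  "babai_cell v = {x. babai_point v x = 0}"

definition error_probability :: "(real ^ 2) set \<Rightarrow> (nat \<Rightarrow> real ^ 2) \<Rightarrow> real" where
  "error_probability L v =
     measure lebesgue (babai_cell v \<inter> - voronoi_cell L) / measure lebesgue (babai_cell v)"

end

theory Submission
  imports Defs
begin

text \<open>
  Reducedness and the angle condition give \<open>0 \<le> a \<le> 1/2\<close> and \<open>1 \<le> a\<^sup>2 + b\<^sup>2\<close>, so \<open>-v\<^sub>2\<close>, \<open>v\<^sub>1\<close> and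
  \<open>v\<^sub>2 - v\<^sub>1\<close> form an obtuse superbase and the Voronoi cell is cut out by \<open>\<plusminus>v\<^sub>1\<close>, \<open>\<plusminus>v\<^sub>2\<close> and
  \<open>\<plusminus>(v\<^sub>2 - v\<^sub>1)\<close>. The first pair holds on the Babai rectangle, whose area is \<open>\<bar>b\<bar>\<close>. Each of the other
  four half planes cuts off a right triangle at one corner of the rectangle; the triangles are
  disjoint, two have area \<open>a (1 - a)\<^sup>2 / (8 \<bar>b\<bar>)\<close> and two have area \<open>a\<^sup>2 (1 - a) / (8 \<bar>b\<bar>)\<close>.
\<close>

subsection \<open>Voronoi cells of planar lattices\<close>

text \<open>Squaring cancels \<open>x \<bullet> x\<close>, so each lattice vector contributes a half
  space, linear in \<open>x\<close>, to the Voronoi cell.\<close>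

lemma norm_le_norm_diff_iff:
  fixes x l :: "'a :: real_inner"
  shows "norm x \<le> norm (x - l) \<longleftrightarrow> 2 * (x \<bullet> l) \<le> l \<bullet> l"
  by (simp add: norm_le inner_diff_left inner_diff_right inner_commute)

text \<open>Nonnegative integers satisfy \<open>k \<le> k\<^sup>2\<close>, and the cross term in
  \<open>l \<bullet> l\<close> is nonnegative. Integrality matters: the bound can fail for
  coefficients strictly between 0 and 1.\<close>

lemma half_space_nonneg_combination:
  fixes x u w :: "'a :: real_inner" and p q :: int
  assumes "0 \<le> u \<bullet> w" "2 * (x \<bullet> u) \<le> u \<bullet> u" "2 * (x \<bullet> w) \<le> w \<bullet> w" "0 \<le> p" "0 \<le> q"
  defines "l \<equiv> of_int p *\<^sub>R u + of_int q *\<^sub>R w"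
  shows "2 * (x \<bullet> l) \<le> l \<bullet> l"
proof -
  have sq: "of_int k \<le> (of_int k :: real)\<^sup>2" if "0 \<le> k" for k :: int
    using that by (metis mult_le_cancel_right1 not_le of_int_le_iff of_int_power
        int_one_le_iff_zero_less power2_eq_square)
  have "2 * (x \<bullet> l) = of_int p * (2 * (x \<bullet> u)) + of_int q * (2 * (x \<bullet> w))"
    by (simp add: l_def inner_add_right)
  also have "\<dots> \<le> of_int p * (u \<bullet> u) + of_int q * (w \<bullet> w)"
    using assms by (intro add_mono mult_left_mono) auto
  also have "\<dots> \<le> (of_int p)\<^sup>2 * (u \<bullet> u) + (of_int q)\<^sup>2 * (w \<bullet> w)"
    using assms sq by (intro add_mono mult_right_mono) auto
  also have "\<dots> \<le> (of_int p)\<^sup>2 * (u \<bullet> u) + (of_int q)\<^sup>2 * (w \<bullet> w) + 2 * (of_int p * of_int q * (u \<bullet> w))"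
    using assms by simp
  also have "\<dots> = l \<bullet> l"
    by (simp add: l_def inner_commute power2_eq_square algebra_simps)
  finally show ?thesis .
qed

text \<open>In the cyclic order \<open>u\<close>, \<open>w\<close>, \<open>w - u\<close>,
  \<open>-u\<close>, \<open>-w\<close>, \<open>u - w\<close>, neighbours have nonnegative inner
  product. Every lattice vector is a nonnegative integer combination of two neighbours, so its half
  space is implied by theirs.\<close>

lemma voronoi_cell_obtuse_superbase:
  fixes u w :: "real ^ 'n"
  assumes L: "L = {of_int m *\<^sub>R u + of_int n *\<^sub>R w | m n :: int. True}"
    and obtuse: "0 \<le> u \<bullet> w" "u \<bullet> w \<le> u \<bullet> u" "u \<bullet> w \<le> w \<bullet> w"
  shows "x \<in> voronoi_cell L \<longleftrightarrow>
    2 * \<bar>x \<bullet> u\<bar> \<le> u \<bullet> u \<and> 2 * \<bar>x \<bullet> w\<bar> \<le> w \<bullet> w \<and> 2 * \<bar>x \<bullet> (w - u)\<bar> \<le> (w - u) \<bullet> (w - u)"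
    (is "_ \<longleftrightarrow> ?R")
proof
  assume x: "x \<in> voronoi_cell L"
  have *: "2 * (x \<bullet> (of_int m *\<^sub>R u + of_int n *\<^sub>R w))
      \<le> (of_int m *\<^sub>R u + of_int n *\<^sub>R w) \<bullet> (of_int m *\<^sub>R u + of_int n *\<^sub>R w)" for m n :: int
    using x unfolding voronoi_cell_def L by (auto simp: norm_le_norm_diff_iff)
  show ?R
    using *[of 1 0] *[of "-1" 0] *[of 0 1] *[of 0 "-1"] *[of "-1" 1] *[of 1 "-1"]
    by (auto simp: abs_le_iff abs_if inner_diff_left inner_diff_right inner_add_left inner_add_right)
next
  assume ?R
  then have R: "2 * \<bar>x \<bullet> u\<bar> \<le> u \<bullet> u" "2 * \<bar>x \<bullet> w\<bar> \<le> w \<bullet> w"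
    "2 * \<bar>x \<bullet> (w - u)\<bar> \<le> (w - u) \<bullet> (w - u)"
    by simp_all
  have abs2: "2 * t \<le> s" "2 * - t \<le> s" if "2 * \<bar>t\<bar> \<le> s" for s t :: real
    using that by linarith+
  have half:
    "2 * (x \<bullet> u) \<le> u \<bullet> u" "2 * (x \<bullet> (-u)) \<le> (-u) \<bullet> (-u)"
    "2 * (x \<bullet> w) \<le> w \<bullet> w" "2 * (x \<bullet> (-w)) \<le> (-w) \<bullet> (-w)"
    "2 * (x \<bullet> (w - u)) \<le> (w - u) \<bullet> (w - u)" "2 * (x \<bullet> (u - w)) \<le> (u - w) \<bullet> (u - w)"
    using R[THEN abs2(1)] R[THEN abs2(2)] by (simp_all add: inner_diff_right inner_diff_left)
  have acute: "0 \<le> w \<bullet> (w - u)" "0 \<le> (w - u) \<bullet> (-u)" "0 \<le> (-u) \<bullet> (-w)"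
    "0 \<le> (-w) \<bullet> (u - w)" "0 \<le> (u - w) \<bullet> u"
    using obtuse by (simp_all add: inner_diff_right inner_diff_left inner_commute)
  have "2 * (x \<bullet> l) \<le> l \<bullet> l" if l: "l = of_int m *\<^sub>R u + of_int n *\<^sub>R w" for l m n
  proof -
    \<comment> \<open>The six sectors between neighbours, in cyclic order; up to sign,
      \<open>m\<close>, \<open>n\<close> and \<open>n + m\<close> are the coefficients of
      \<open>l\<close> there.\<close>
    consider "0 \<le> m" "0 \<le> n" | "m \<le> 0" "0 \<le> n + m" | "0 \<le> n" "n + m \<le> 0"
      | "m \<le> 0" "n \<le> 0" | "0 \<le> m" "n + m \<le> 0" | "n \<le> 0" "0 \<le> n + m"
      by linarith
    then show ?thesis
    proof cases
      case 1
      then show ?thesis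
        using half_space_nonneg_combination[OF obtuse(1) half(1,3), of m n] l by simp
    next
      case 2
      have "l = of_int (n + m) *\<^sub>R w + of_int (- m) *\<^sub>R (w - u)"
        by (simp add: l algebra_simps)
      with 2 half_space_nonneg_combination[OF acute(1) half(3,5), of "n + m" "-m"]
      show ?thesis by simp
    next
      case 3
      have "l = of_int n *\<^sub>R (w - u) + of_int (- n - m) *\<^sub>R (- u)"
        by (simp add: l algebra_simps)
      with 3 half_space_nonneg_combination[OF acute(2) half(5,2), of n "-n - m"]
      show ?thesis by simp
    next
      case 4
      have "l = of_int (- m) *\<^sub>R (- u) + of_int (- n) *\<^sub>R (- w)"
        by (simp add: l algebra_simps)
      with 4 half_space_nonneg_combination[OF acute(3) half(2,4), of "-m" "-n"]
      show ?thesis by simp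
    next
      case 5
      have "l = of_int (- n - m) *\<^sub>R (- w) + of_int m *\<^sub>R (u - w)"
        by (simp add: l algebra_simps)
      with 5 half_space_nonneg_combination[OF acute(4) half(4,6), of "-n - m" m]
      show ?thesis by simp
    next
      case 6
      have "l = of_int (- n) *\<^sub>R (u - w) + of_int (n + m) *\<^sub>R u"
        by (simp add: l algebra_simps)
      with 6 half_space_nonneg_combination[OF acute(5) half(6,1), of "-n" "n + m"]
      show ?thesis by simp
    qed
  qed
  then show "x \<in> voronoi_cell L"
    unfolding voronoi_cell_def L by (auto simp: norm_le_norm_diff_iff)
qed

subsection \<open>Planar areas\<close>

lemma inner_real_2: "(x :: real ^ 2) \<bullet> y = x $ 1 * y $ 1 + x $ 2 * y $ 2"
  by (simp add: inner_vec_def sum_2)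

lemma vec_eq_2_iff: "(x :: 'a ^ 2) = y \<longleftrightarrow> x $ 1 = y $ 1 \<and> x $ 2 = y $ 2"
  by (simp add: vec_eq_iff forall_2)

lemma negligible_line:
  fixes \<alpha> \<beta> c :: real
  assumes "\<alpha> \<noteq> 0 \<or> \<beta> \<noteq> 0"
  shows "negligible {x :: real ^ 2. \<alpha> * x $ 1 + \<beta> * x $ 2 = c}"
  using negligible_hyperplane[of "vector [\<alpha>, \<beta>] :: real ^ 2" c] assms
  by (auto simp: inner_real_2 vec_eq_2_iff)

text \<open>Allows sets with only part of their boundary to be replaced by compact ones.
  Measurability of \<open>S\<close> is a conclusion, thanks to completeness of Lebesgue
  measure.\<close>

lemma measure_lebesgue_sandwich:
  fixes S T :: "'a :: euclidean_space set"
  assumes "T \<in> lmeasurable" "S \<subseteq> T" "negligible N" "T \<subseteq> S \<union> N"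
  shows "S \<in> lmeasurable" "measure lebesgue S = measure lebesgue T"
proof -
  have "(T - S) \<union> (S - T) \<subseteq> N" using assms by auto
  then have neg: "negligible ((T - S) \<union> (S - T))"
    using assms(3) negligible_subset by blast
  show "S \<in> lmeasurable" "measure lebesgue S = measure lebesgue T"
    using lmeasurable_negligible_symdiff[OF assms(1) neg] measure_negligible_symdiff[OF assms(1) neg]
    by auto
qed

text \<open>
  The triangle has its right angle at \<open>p\<close> and signed legs \<open>\<gamma> / \<alpha>\<close>, \<open>\<gamma> / \<beta>\<close>; \<open>S\<close> may contain any part of its boundary.
\<close>

lemma measure_right_triangle:
  fixes p :: "real ^ 2" and S :: "(real ^ 2) set" and \<alpha> \<beta> \<gamma> :: real
  assumes nz: "\<alpha> \<noteq> 0" "\<beta> \<noteq> 0" "0 < \<gamma>"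
    and inner: "\<And>x. 0 < \<alpha> * (p $ 1 - x $ 1) \<Longrightarrow> 0 < \<beta> * (p $ 2 - x $ 2) \<Longrightarrow>
          \<alpha> * (p $ 1 - x $ 1) + \<beta> * (p $ 2 - x $ 2) < \<gamma> \<Longrightarrow> x \<in> S"
    and outer: "\<And>x. x \<in> S \<Longrightarrow> 0 \<le> \<alpha> * (p $ 1 - x $ 1) \<and> 0 \<le> \<beta> * (p $ 2 - x $ 2) \<and>
          \<alpha> * (p $ 1 - x $ 1) + \<beta> * (p $ 2 - x $ 2) \<le> \<gamma>"
  shows "S \<in> lmeasurable" "measure lebesgue S = \<gamma>\<^sup>2 / (2 * \<bar>\<alpha> * \<beta>\<bar>)"
proof -
  define A B where "A = (vector [p $ 1 - \<gamma> / \<alpha>, p $ 2] :: real ^ 2)"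
    and "B = (vector [p $ 1, p $ 2 - \<gamma> / \<beta>] :: real ^ 2)"
  define T where "T = convex hull {p, A, B}"
  \<comment> \<open>The lines that carry the three sides of the triangle.\<close>
  define N where "N = {x :: real ^ 2. \<alpha> * x $ 1 + 0 * x $ 2 = \<alpha> * p $ 1} \<union>
    {x. 0 * x $ 1 + \<beta> * x $ 2 = \<beta> * p $ 2} \<union>
    {x. \<alpha> * x $ 1 + \<beta> * x $ 2 = \<alpha> * p $ 1 + \<beta> * p $ 2 - \<gamma>}"
  have neg: "negligible N"
    unfolding N_def using nz by (intro negligible_Un negligible_line) auto
  have T: "T \<in> lmeasurable"
    unfolding T_def by (intro lmeasurable_compact compact_convex_hull) auto
  have ST: "S \<subseteq> T"
  proof
    fix x assume "x \<in> S"
    note o = outer[OF this]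
    \<comment> \<open>Barycentric coordinates of \<open>x\<close> with respect to \<open>A\<close>
      and \<open>B\<close>; the corner \<open>p\<close> gets the weight
      \<open>1 - s - t\<close>.\<close>
    define s t where "s = \<alpha> * (p $ 1 - x $ 1) / \<gamma>" and "t = \<beta> * (p $ 2 - x $ 2) / \<gamma>"
    have "s + t = (\<alpha> * (p $ 1 - x $ 1) + \<beta> * (p $ 2 - x $ 2)) / \<gamma>"
      by (simp add: s_def t_def add_divide_distrib)
    with o nz have st: "0 \<le> s" "0 \<le> t" "s + t \<le> 1"
      by (auto simp: s_def t_def)
    have "x = (1 - s - t) *\<^sub>R p + s *\<^sub>R A + t *\<^sub>R B"
      using nz by (simp add: vec_eq_2_iff A_def B_def s_def t_def) (simp add: field_simps)
    with st show "x \<in> T"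
      unfolding T_def convex_hull_3
      by (smt (verit, ccfv_SIG) mem_Collect_eq)
  qed
  have TS: "T \<subseteq> S \<union> N"
  proof
    fix x assume "x \<in> T"
    then obtain r s t where rst: "0 \<le> r" "0 \<le> s" "0 \<le> t" "r + s + t = 1"
      and x: "x = r *\<^sub>R p + s *\<^sub>R A + t *\<^sub>R B"
      unfolding T_def convex_hull_3 by blast
    have r: "r = 1 - s - t" using rst by simp
    have "\<alpha> * (p $ 1 - x $ 1) = \<gamma> * s" "\<beta> * (p $ 2 - x $ 2) = \<gamma> * t"
      using nz by (simp_all add: x r A_def B_def field_simps)
    moreover have "0 \<le> \<gamma> * s" "0 \<le> \<gamma> * t" "\<gamma> * s + \<gamma> * t \<le> \<gamma>"
      using rst nz by (auto simp: distrib_left[symmetric])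
    \<comment> \<open>Either all three inequalities are strict and \<open>inner\<close> applies, or
      one is an equality and \<open>x\<close> lies on a side.\<close>
    ultimately show "x \<in> S \<union> N"
      using inner[of x] unfolding N_def by (force simp: algebra_simps)
  qed
  show "S \<in> lmeasurable"
    using measure_lebesgue_sandwich(1)[OF T ST neg TS] .
  have "measure lebesgue S = measure lebesgue T"
    using measure_lebesgue_sandwich(2)[OF T ST neg TS] .
  also have "\<dots> = measure lborel T"
    using T_def by (simp add: compact_imp_closed borel_closed compact_convex_hull)
  also have "\<dots> = \<bar>(\<gamma> / \<alpha>) * (\<gamma> / \<beta>)\<bar> / 2"
    unfolding T_def content_triangle by (simp add: A_def B_def)
  also have "\<dots> = \<gamma>\<^sup>2 / (2 * \<bar>\<alpha> * \<beta>\<bar>)"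
    using nz by (simp add: power2_eq_square abs_mult)
  finally show "measure lebesgue S = \<gamma>\<^sup>2 / (2 * \<bar>\<alpha> * \<beta>\<bar>)" .
qed

subsection \<open>The lattice with basis \<open>(1, 0)\<close>, \<open>(a, b)\<close>\<close>

lemma atLeastAtMost_1_2: "{1..CARD(2)} = {1, 2 :: nat}"
  by auto

lemma independent_pair_iff:
  fixes a b :: real
  shows "vector [1, 0] \<noteq> (vector [a, b] :: real ^ 2) \<and> independent {vector [1, 0], vector [a, b] :: real ^ 2}
    \<longleftrightarrow> b \<noteq> 0"
proof -
  have "(vector [a, b] :: real ^ 2) \<in> span {vector [1, 0]} \<longleftrightarrow> b = 0"
    by (auto simp: span_singleton vec_eq_2_iff image_iff)
  then show ?thesis
    by (auto simp: independent_insert insert_commute[of "vector [1, 0]"] vec_eq_2_iff)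
qed

text \<open>Replaces coefficient functions by two integer parameters. \<open>One_nat_def\<close> is
  switched off so that \<open>v 1\<close> does not become \<open>v (Suc 0)\<close>.\<close>

lemma lattice_basis_2_iff:
  notes One_nat_def [simp del]
  shows
  "lattice_basis L (v :: nat \<Rightarrow> real ^ 2) \<longleftrightarrow> v 1 \<noteq> v 2 \<and> independent {v 1, v 2} \<and>
     L = {of_int m *\<^sub>R v 1 + of_int n *\<^sub>R v 2 | m n :: int. True}"
proof -
  have "{(\<Sum>i = 1..CARD(2). real_of_int (c i) *\<^sub>R v i) | c. True} =
      {of_int m *\<^sub>R v 1 + of_int n *\<^sub>R v 2 | m n :: int. True}" (is "?A = ?B")
  proof
    show "?A \<subseteq> ?B" unfolding atLeastAtMost_1_2 by auto
    show "?B \<subseteq> ?A"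
    proof
      fix x assume "x \<in> ?B"
      then obtain m n :: int where "x = of_int m *\<^sub>R v 1 + of_int n *\<^sub>R v 2" by auto
      then show "x \<in> ?A"
        unfolding atLeastAtMost_1_2
        by (intro CollectI exI[of _ "\<lambda>i. if i = 1 then m else n"]) simp
    qed
  qed
  then show ?thesis
    unfolding lattice_basis_def atLeastAtMost_1_2 by auto
qed

text \<open>Two competing bases suffice: \<open>v 2, v 1\<close> bounds the norm of
  \<open>v 2\<close> from below, and \<open>v 1, v 2 - v 1\<close> bounds \<open>a\<close> from
  above. The sign of \<open>a\<close> is left to the angle condition.\<close>

lemma minkowski_reduced_bounds:
  fixes L :: "(real ^ 2) set" and a b :: real
  notes One_nat_def [simp del]
  assumes red: "minkowski_reduced L v" and v: "v 1 = vector [1, 0]" "v 2 = vector [a, b]"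
  shows "b \<noteq> 0" "1 \<le> a\<^sup>2 + b\<^sup>2" "2 * a \<le> 1"
    and "L = {of_int m *\<^sub>R vector [1, 0] + of_int n *\<^sub>R vector [a, b] | m n :: int. True}"
proof -
  have bas: "lattice_basis L v"
    using red by (simp add: minkowski_reduced_def)
  then have neq: "v 1 \<noteq> v 2" and ind: "independent {v 1, v 2}"
    and L: "L = {of_int m *\<^sub>R v 1 + of_int n *\<^sub>R v 2 | m n :: int. True}"
    by (auto simp: lattice_basis_2_iff)
  show b: "b \<noteq> 0" using neq ind v independent_pair_iff by metis
  show "L = {of_int m *\<^sub>R vector [1, 0] + of_int n *\<^sub>R vector [a, b] | m n :: int. True}"
    using L v by simp
  \<comment> \<open>For \<open>j = 1\<close> no vector is prescribed, so the first vector of any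
    basis competes with \<open>v 1\<close>.\<close>
  have swap: "lattice_basis L (v(1 := v 2, 2 := v 1))"
    unfolding lattice_basis_2_iff using neq ind L
    by (auto simp: insert_commute) (metis add.commute)+
  have "norm (v 1) \<le> norm (v 2)"
    using red swap unfolding minkowski_reduced_def by fastforce
  then show "1 \<le> a\<^sup>2 + b\<^sup>2"
    by (simp add: v norm_le inner_real_2 power2_eq_square)
  have diff: "v 2 - v 1 = vector [a - 1, b]"
    by (simp add: v vec_eq_2_iff)
  have "L = {of_int m *\<^sub>R v 1 + of_int n *\<^sub>R (v 2 - v 1) | m n :: int. True}" (is "L = ?M")
  proof
    show "L \<subseteq> ?M"
    proof
      fix x assume "x \<in> L"
      then obtain m n :: int where "x = of_int m *\<^sub>R v 1 + of_int n *\<^sub>R v 2" unfolding L by auto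
      then have "x = of_int (m + n) *\<^sub>R v 1 + of_int n *\<^sub>R (v 2 - v 1)"
        by (simp add: algebra_simps)
      then show "x \<in> ?M" by blast
    qed
    show "?M \<subseteq> L"
    proof
      fix x assume "x \<in> ?M"
      then obtain m n :: int where "x = of_int m *\<^sub>R v 1 + of_int n *\<^sub>R (v 2 - v 1)" by auto
      then have "x = of_int (m - n) *\<^sub>R v 1 + of_int n *\<^sub>R v 2"
        by (simp add: algebra_simps)
      then show "x \<in> L" unfolding L by blast
    qed
  qed
  then have "lattice_basis L (v(2 := v 2 - v 1))"
    unfolding lattice_basis_2_iff using independent_pair_iff[of "a - 1" b] b
    by (simp add: diff) (simp add: v diff[unfolded v])
  then have "norm (v 2) \<le> norm (v 2 - v 1)"
    using red unfolding minkowski_reduced_def by fastforce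
  then show "2 * a \<le> 1"
    by (simp add: v diff norm_le inner_real_2 power2_eq_square algebra_simps)
qed

text \<open>\<open>arccos\<close> is decreasing on [-1, 1], and Cauchy-Schwarz puts the quotient
  there. For a zero vector the quotient is 0 by the convention on division.\<close>

lemma vec_angle_le_pi_half:
  fixes x y :: "real ^ 'n"
  assumes "vec_angle x y \<le> pi / 2"
  shows "0 \<le> x \<bullet> y"
proof -
  define t where "t = (x \<bullet> y) / (norm x * norm y)"
  have "\<bar>t\<bar> \<le> 1"
    using Cauchy_Schwarz_ineq2[of x y] by (cases "x = 0 \<or> y = 0") (auto simp: t_def)
  moreover have "arccos t \<le> arccos 0"
    using assms by (simp add: vec_angle_def t_def)
  ultimately have "0 \<le> t"
    by (subst (asm) arccos_le_mono) auto
  moreover have "x \<bullet> y = t * (norm x * norm y)"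
    by (auto simp: t_def)
  ultimately show ?thesis by simp
qed

section \<open>The Babai rectangle and the part of it outside the Voronoi cell\<close>

lemma round_eq_0_iff: "round t = 0 \<longleftrightarrow> - 1 / 2 \<le> t \<and> t < 1 / 2" for t :: real
  by (auto simp: round_def floor_eq_iff)

text \<open>The Gram-Schmidt vectors are (1, 0) and (0, b), so the algorithm rounds along the axes.
  The second coordinate stays multiplied by \<open>b\<close> because the sign of \<open>b\<close>,
  which decides which horizontal edge is included, is not fixed.\<close>

lemma babai_cell_2:
  fixes v :: "nat \<Rightarrow> real ^ 2"
  notes One_nat_def [simp del]
  assumes v: "v 1 = vector [1, 0]" "v 2 = vector [a, b]" and b: "b \<noteq> 0"
  shows "babai_cell v = {x. - 1 / 2 \<le> x $ 1 \<and> x $ 1 < 1 / 2 \<and> - b\<^sup>2 / 2 \<le> b * x $ 2 \<and> b * x $ 2 < b\<^sup>2 / 2}"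
proof -
  have sp0: "basis_span v 0 = {0}" by (simp add: basis_span_def)
  have sp1: "basis_span v 1 = {x. x $ 2 = 0}"
    by (auto simp: basis_span_def v span_singleton vec_eq_2_iff)
  have P0: "orth_proj (basis_span v 0) x = 0" for x
    by (rule orth_proj_eqI) (auto simp: sp0 orthogonal_def)
  have P1: "orth_proj (basis_span v 1) x = vector [x $ 1, 0]" for x
    by (rule orth_proj_eqI)
      (auto simp: sp1 orthogonal_def inner_real_2 subspace_def)
  have perp1: "basis_perp v 1 = vector [1, 0]"
    using P0 by (simp add: basis_perp_def basis_par_def v)
  have par2: "basis_par v 2 = vector [a, 0]"
    using P1[of "v 2"] by (simp add: basis_par_def v One_nat_def)
  have perp2: "basis_perp v 2 = vector [0, b]"
    by (simp add: basis_perp_def par2 v vec_eq_2_iff)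
  have c1: "babai_coeff v 1 z = round (z $ 1)" for z
    by (simp add: babai_coeff_def perp1 inner_real_2 power2_norm_eq_inner)
  have c2: "babai_coeff v 2 z = round (b * z $ 2 / b\<^sup>2)" for z
    by (simp add: babai_coeff_def perp2 inner_real_2 power2_norm_eq_inner mult.commute flip: power2_eq_square)
  have pt: "babai_point v x = of_int (babai_coeff v 1 (babai_step v 2 x)) *\<^sub>R v 1
      + of_int (babai_coeff v 2 x) *\<^sub>R v 2" for x
    by (simp add: babai_point_def numeral_2_eq_2 One_nat_def)
  have "babai_point v x = 0 \<longleftrightarrow> round (b * x $ 2 / b\<^sup>2) = 0 \<and> round (x $ 1) = 0" for x
  proof -
    have "babai_point v x = 0 \<longleftrightarrow>
        babai_coeff v 2 x = 0 \<and> babai_coeff v 1 (babai_step v 2 x) = 0"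
      using b by (auto simp: pt vec_eq_2_iff v)
    \<comment> \<open>No multiple of \<open>basis_par v 2\<close> is subtracted here, so
      \<open>a\<close> drops out of the first rounding.\<close>
    moreover have "babai_step v 2 x = vector [x $ 1, 0]" if "babai_coeff v 2 x = 0"
      using that P1[of x] by (simp add: babai_step_def One_nat_def)
    ultimately show ?thesis
      using c1 c2 by auto
  qed
  then show ?thesis
    using b by (auto simp: babai_cell_def round_eq_0_iff field_simps)
qed

lemma measure_babai_cell_2:
  fixes v :: "nat \<Rightarrow> real ^ 2"
  assumes v: "v 1 = vector [1, 0]" "v 2 = vector [a, b]" and b: "b \<noteq> 0"
  shows "measure lebesgue (babai_cell v) = \<bar>b\<bar>"
proof -
  define R where "R = cbox (vector [- 1 / 2, - \<bar>b\<bar> / 2]) (vector [1 / 2, \<bar>b\<bar> / 2] :: real ^ 2)"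
  \<comment> \<open>Lines through the two edges that the half-open cell omits.\<close>
  define N where "N = {x :: real ^ 2. 1 * x $ 1 + 0 * x $ 2 = 1 / 2} \<union>
    {x. 0 * x $ 1 + b * x $ 2 = b\<^sup>2 / 2}"
  have bb: "b\<^sup>2 = \<bar>b\<bar> * \<bar>b\<bar>" by (simp add: power2_eq_square)
  have iff: "\<bar>b * t\<bar> \<le> b\<^sup>2 / 2 \<longleftrightarrow> \<bar>t\<bar> \<le> \<bar>b\<bar> / 2" for t
    using b mult_le_cancel_left_pos[of "\<bar>b\<bar>" "\<bar>t\<bar>" "\<bar>b\<bar> / 2"] by (simp add: abs_mult bb)
  have R: "x \<in> R \<longleftrightarrow> - 1 / 2 \<le> x $ 1 \<and> x $ 1 \<le> 1 / 2 \<and> - b\<^sup>2 / 2 \<le> b * x $ 2 \<and> b * x $ 2 \<le> b\<^sup>2 / 2" for x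
    using iff[of "x $ 2"] by (auto simp: R_def mem_box_cart forall_2 abs_le_iff)
  have "R \<in> lmeasurable" by (simp add: R_def)
  moreover have "babai_cell v \<subseteq> R"
    by (auto simp: R babai_cell_2[OF v b])
  moreover have "negligible N"
    unfolding N_def using b by (intro negligible_Un negligible_line) auto
  moreover have "R \<subseteq> babai_cell v \<union> N"
    by (auto simp: R N_def babai_cell_2[OF v b])
  ultimately have "measure lebesgue (babai_cell v) = measure lebesgue R"
    by (rule measure_lebesgue_sandwich(2))
  also have "\<dots> = measure lborel R" by (simp add: R_def)
  also have "\<dots> = \<bar>b\<bar>"
    unfolding R_def by (subst content_cbox_cart) (auto simp: interval_ne_empty_cart forall_2 UNIV_2)
  finally show ?thesis .
qed

text \<open>The vectors \<open>v 2\<close> and \<open>v 2 - v 1\<close> have the form (\<alpha>, b)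
  with \<alpha> equal to \<open>a\<close> or \<open>a - 1\<close>. Both values give
  \<open>\<bar>\<alpha>\<bar> - \<alpha>\<^sup>2 = a - a\<^sup>2\<close>, so one computation covers
  all four corner pieces.\<close>

lemma measure_babai_minus_voronoi:
  fixes L :: "(real ^ 2) set" and v :: "nat \<Rightarrow> real ^ 2"
  assumes v: "v 1 = vector [1, 0]" "v 2 = vector [a, b]"
    and b: "b \<noteq> 0" and ab: "1 \<le> a\<^sup>2 + b\<^sup>2" and a: "0 \<le> a" "2 * a \<le> 1"
    and L: "L = {of_int m *\<^sub>R vector [1, 0] + of_int n *\<^sub>R vector [a, b] | m n :: int. True}"
  shows "measure lebesgue (babai_cell v \<inter> - voronoi_cell L) = (a - a\<^sup>2) / (4 * \<bar>b\<bar>)"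
proof -
  let ?B = "babai_cell v"
  note B = babai_cell_2[OF v b]
  have a2: "a\<^sup>2 \<le> a / 2" using a by (simp add: power2_eq_square mult_left_mono[of a "1/2" a, simplified])
  have vor: "x \<in> voronoi_cell L \<longleftrightarrow> 2 * \<bar>x $ 1\<bar> \<le> 1 \<and> 2 * \<bar>a * x $ 1 + b * x $ 2\<bar> \<le> a\<^sup>2 + b\<^sup>2 \<and>
      2 * \<bar>(a - 1) * x $ 1 + b * x $ 2\<bar> \<le> (a - 1)\<^sup>2 + b\<^sup>2" for x
    by (subst voronoi_cell_obtuse_superbase[OF L])
      (use a a2 ab in \<open>auto simp: inner_real_2 power2_eq_square algebra_simps\<close>)
  define D where "D = (\<lambda>\<alpha>. ?B \<inter> {x. \<alpha>\<^sup>2 + b\<^sup>2 < 2 * (\<alpha> * x $ 1 + b * x $ 2)})"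
  define D' where "D' = (\<lambda>\<alpha>. ?B \<inter> {x. \<alpha>\<^sup>2 + b\<^sup>2 < - 2 * (\<alpha> * x $ 1 + b * x $ 2)})"
  have split: "?B \<inter> - voronoi_cell L = (D a \<union> D' a) \<union> (D (a - 1) \<union> D' (a - 1))"
  proof -
    have abs2: "2 * \<bar>t\<bar> \<le> s \<longleftrightarrow> \<not> s < 2 * t \<and> \<not> s < - 2 * t" for s t :: real
      by linarith
    have "2 * \<bar>x $ 1\<bar> \<le> 1" if "x \<in> ?B" for x
      using that by (auto simp: B)
    then show ?thesis
      unfolding D_def D'_def by (auto simp: vor abs2)
  qed
  show ?thesis
  \<comment> \<open>The triangle computation divides by \<alpha>, which vanishes for
    \<open>\<alpha> = a = 0\<close>; all pieces are then empty.\<close>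
  proof (cases "a = 0")
    case True
    then have "D a \<union> D' a \<union> (D (a - 1) \<union> D' (a - 1)) = {}"
      by (auto simp: D_def D'_def B)
    with split True show ?thesis by simp
  next
    case False
    with a have pos: "0 < a" "0 < 1 - a" by auto
    \<comment> \<open>The amount by which \<open>\<alpha> * p $ 1 + b * p $ 2\<close> at the cut
      corner \<open>p\<close> exceeds \<open>(\<alpha>\<^sup>2 + b\<^sup>2) / 2\<close>.\<close>
    define \<gamma> where "\<gamma> = (a - a\<^sup>2) / 2"
    \<comment> \<open>The second bound makes the vertical leg
      \<open>\<gamma> / \<bar>b\<bar>\<close> shorter than the rectangle's height, so the triangle
      stays inside.\<close>
    have \<gamma>: "0 < \<gamma>" "\<gamma> < b\<^sup>2" using a2 ab a pos by (auto simp: \<gamma>_def)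
    have sep: "D \<alpha> \<in> lmeasurable \<and> measure lebesgue (D \<alpha>) = \<gamma>\<^sup>2 / (2 * \<bar>\<alpha> * b\<bar>) \<and>
        D' \<alpha> \<in> lmeasurable \<and> measure lebesgue (D' \<alpha>) = \<gamma>\<^sup>2 / (2 * \<bar>\<alpha> * b\<bar>)"
      if \<alpha>: "\<alpha> \<noteq> 0" "\<bar>\<alpha>\<bar> - \<alpha>\<^sup>2 = 2 * \<gamma>" for \<alpha>
    proof -
      \<comment> \<open>The corner of the rectangle maximizing the functional of (\<alpha>,
        b).\<close>
      define p where "p = (vector [sgn \<alpha> / 2, b / 2] :: real ^ 2)"
      have corner: "\<alpha> * p $ 1 = \<bar>\<alpha>\<bar> / 2" "b * p $ 2 = b\<^sup>2 / 2"
        by (simp_all add: p_def abs_sgn power2_eq_square)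
      have coord: "- (1 / 2) \<le> t \<and> t < 1 / 2" if "\<bar>\<alpha> * t\<bar> < \<bar>\<alpha>\<bar> / 2" for t
      proof -
        have "\<bar>\<alpha>\<bar> * \<bar>t\<bar> < \<bar>\<alpha>\<bar> * (1 / 2)" using that by (simp add: abs_mult)
        then have "\<bar>t\<bar> < 1 / 2" using \<alpha>(1) by (subst (asm) mult_less_cancel_left_pos) auto
        then show ?thesis by auto
      qed
      have edge: "\<bar>\<alpha> * t\<bar> \<le> \<bar>\<alpha>\<bar> / 2" if "- (1 / 2) \<le> t" "t < 1 / 2" for t
      proof -
        have "\<bar>\<alpha>\<bar> * \<bar>t\<bar> \<le> \<bar>\<alpha>\<bar> * (1 / 2)" using that by (intro mult_left_mono) auto
        then show ?thesis by (simp add: abs_mult)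
      qed
      have sq: "0 < \<alpha>\<^sup>2" using \<alpha> by simp
      have 1: "x \<in> D \<alpha>" if "0 < \<alpha> * (p $ 1 - x $ 1)" "0 < b * (p $ 2 - x $ 2)"
          "\<alpha> * (p $ 1 - x $ 1) + b * (p $ 2 - x $ 2) < \<gamma>" for x
        using that coord[of "x $ 1"] \<gamma> \<alpha>(2) sq
        by (auto simp: D_def B right_diff_distrib corner)
      have 2: "0 \<le> \<alpha> * (p $ 1 - x $ 1) \<and> 0 \<le> b * (p $ 2 - x $ 2) \<and>
          \<alpha> * (p $ 1 - x $ 1) + b * (p $ 2 - x $ 2) \<le> \<gamma>" if "x \<in> D \<alpha>" for x
        using that edge[of "x $ 1"] \<alpha>(2) by (auto simp: D_def B right_diff_distrib corner)
      \<comment> \<open>\<open>D' \<alpha>\<close> mirrors \<open>D \<alpha>\<close> in the origin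
        only up to boundary, since the cell is half-open; the triangle lemma is applied afresh with
        all signs reversed.\<close>
      have 3: "x \<in> D' \<alpha>" if "0 < - \<alpha> * ((- p) $ 1 - x $ 1)" "0 < - b * ((- p) $ 2 - x $ 2)"
          "- \<alpha> * ((- p) $ 1 - x $ 1) + - b * ((- p) $ 2 - x $ 2) < \<gamma>" for x
        using that coord[of "x $ 1"] \<gamma> \<alpha>(2) sq
        by (auto simp: D'_def B right_diff_distrib corner)
      have 4: "0 \<le> - \<alpha> * ((- p) $ 1 - x $ 1) \<and> 0 \<le> - b * ((- p) $ 2 - x $ 2) \<and>
          - \<alpha> * ((- p) $ 1 - x $ 1) + - b * ((- p) $ 2 - x $ 2) \<le> \<gamma>" if "x \<in> D' \<alpha>" for x
        using that edge[of "x $ 1"] \<alpha>(2) by (auto simp: D'_def B right_diff_distrib corner)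
      show ?thesis
        using measure_right_triangle[OF \<alpha>(1) b \<gamma>(1) 1 2]
          measure_right_triangle[of "- \<alpha>" "- b" \<gamma> "- p" "D' \<alpha>"] 3 4 \<alpha>(1) b \<gamma>(1)
        by simp
    qed
    have tri: "D a \<in> lmeasurable" "D' a \<in> lmeasurable" "D (a - 1) \<in> lmeasurable" "D' (a - 1) \<in> lmeasurable"
      "measure lebesgue (D a) = \<gamma>\<^sup>2 / (2 * (a * \<bar>b\<bar>))" "measure lebesgue (D' a) = \<gamma>\<^sup>2 / (2 * (a * \<bar>b\<bar>))"
      "measure lebesgue (D (a - 1)) = \<gamma>\<^sup>2 / (2 * ((1 - a) * \<bar>b\<bar>))"
      "measure lebesgue (D' (a - 1)) = \<gamma>\<^sup>2 / (2 * ((1 - a) * \<bar>b\<bar>))"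
      using sep[of a] sep[of "a - 1"] pos
      by (simp_all add: \<gamma>_def abs_mult power2_diff)
    have ax: "\<bar>a * x $ 1\<bar> \<le> a / 2" "\<bar>(a - 1) * x $ 1\<bar> \<le> (1 - a) / 2" if "x \<in> ?B" for x
      using that pos mult_left_mono[of "\<bar>x $ 1\<bar>" "1/2" a] mult_left_mono[of "\<bar>x $ 1\<bar>" "1/2" "1 - a"]
      by (auto simp: B abs_mult)
    have disj: "D a \<inter> D' a = {}" "D (a - 1) \<inter> D' (a - 1) = {}"
      using b by (auto simp: D_def D'_def) (smt (verit) zero_le_power2)+
    have corners: "x \<notin> D a \<inter> D (a - 1)" "x \<notin> D a \<inter> D' (a - 1)"
      "x \<notin> D' a \<inter> D (a - 1)" "x \<notin> D' a \<inter> D' (a - 1)" for x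
    proof -
      \<comment> \<open>Since \<open>a\<close> and \<open>a - 1\<close> have opposite signs,
        \<open>D a\<close> and \<open>D (a - 1)\<close> lie on opposite sides of the vertical axis,
        and so do \<open>D' a\<close> and \<open>D' (a - 1)\<close>.\<close>
      have "\<not> (0 < a * x $ 1 \<and> 0 < (a - 1) * x $ 1)" "\<not> (0 > a * x $ 1 \<and> 0 > (a - 1) * x $ 1)"
        using pos by (auto simp: zero_less_mult_iff mult_less_0_iff)
      moreover have "0 < \<alpha> * x $ 1" if "x \<in> D \<alpha>" for \<alpha>
      proof -
        have "b * x $ 2 < b\<^sup>2 / 2" "\<alpha>\<^sup>2 + b\<^sup>2 < 2 * (\<alpha> * x $ 1 + b * x $ 2)"
          using that by (simp_all add: D_def B)
        then have "\<alpha>\<^sup>2 < 2 * (\<alpha> * x $ 1)" by simp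
        from le_less_trans[OF zero_le_power2 this] show ?thesis by simp
      qed
      moreover have "\<alpha> * x $ 1 < 0" if "x \<in> D' \<alpha>" for \<alpha>
      proof -
        have "- b\<^sup>2 / 2 \<le> b * x $ 2" "\<alpha>\<^sup>2 + b\<^sup>2 < - 2 * (\<alpha> * x $ 1 + b * x $ 2)"
          using that by (simp_all add: D'_def B)
        then have "\<alpha>\<^sup>2 < - 2 * (\<alpha> * x $ 1)" by simp
        from le_less_trans[OF zero_le_power2 this] show ?thesis by simp
      qed
      ultimately show "x \<notin> D a \<inter> D (a - 1)" "x \<notin> D' a \<inter> D' (a - 1)"
        by blast+
      \<comment> \<open>For the mixed pairs, adding the two defining inequalities cancels
        \<open>b * x $ 2\<close> and leaves a sum of squared norms, at least 1, strictly below
        \<open>2 * \<bar>x $ 1\<bar>\<close>, which is at most 1.\<close>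
      have "(a - 1) * x $ 1 = a * x $ 1 - x $ 1"
        by (simp add: algebra_simps)
      moreover have "1 \<le> (a\<^sup>2 + b\<^sup>2) + ((a - 1)\<^sup>2 + b\<^sup>2)"
        by (rule add_increasing2[OF _ ab]) simp
      ultimately show "x \<notin> D a \<inter> D' (a - 1)" "x \<notin> D' a \<inter> D (a - 1)"
        by (auto simp: D_def D'_def B)
    qed
    then have sides: "(D a \<union> D' a) \<inter> (D (a - 1) \<union> D' (a - 1)) = {}"
      by blast
    have m: "D a \<union> D' a \<in> lmeasurable" "D (a - 1) \<union> D' (a - 1) \<in> lmeasurable"
      using tri by auto
    have "measure lebesgue (?B \<inter> - voronoi_cell L) = \<gamma>\<^sup>2 / (a * \<bar>b\<bar>) + \<gamma>\<^sup>2 / ((1 - a) * \<bar>b\<bar>)"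
      unfolding split using tri m disj sides by (simp add: measure_Un3)
    also have "\<dots> = \<gamma>\<^sup>2 / (a * (1 - a)) / \<bar>b\<bar>"
      using pos b by (simp add: field_simps)
    \<comment> \<open>Here \<open>a * (1 - a) = 2 * \<gamma>\<close>, so the quotient is
      \<open>\<gamma> / 2\<close>.\<close>
    also have "\<gamma>\<^sup>2 / (a * (1 - a)) = (a - a\<^sup>2) / 4"
      using pos by (simp add: \<gamma>_def field_simps power2_eq_square)
    finally show ?thesis by simp
  qed
qed

theorem theorem1:
  fixes L :: "(real ^ 2) set" and v :: "nat \<Rightarrow> real ^ 2" and a b \<theta> :: real
  assumes "minkowski_reduced L v"
    and "v 1 = vector [1, 0]" and "v 2 = vector [a, b]"
    and "\<theta> = vec_angle (v 1) (v 2)"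
    and "pi / 3 \<le> \<theta>" and "\<theta> \<le> pi / 2"
  shows "error_probability L v = (a - a\<^sup>2) / (4 * b\<^sup>2)"
proof -
  note bounds = minkowski_reduced_bounds[OF assms(1-3)]
  have "0 \<le> a"
    using vec_angle_le_pi_half[of "v 1" "v 2"] assms by (simp add: inner_real_2)
  then show ?thesis
    unfolding error_probability_def
    using measure_babai_cell_2[OF assms(2,3) bounds(1)]
      measure_babai_minus_voronoi[OF assms(2,3) bounds(1,2) _ bounds(3,4)]
    by (simp add: power2_eq_square)
qed

end
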